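(* Let $b\in\mathbb{N}$ and let $a$ be a real number with $\frac{1}{b}<a<1$. Let $\phi:[0,1]\to\mathbb{R}$ be a $C^1$ function with $\phi(0)=\phi(1)$, and denote also by $\phi:\mathbb{R}\to\mathbb{R}$ its $\mathbb{Z}$-periodic extension. Define $$w^{\phi}_{a,b}(x)=\sum_{n=0}^{\infty}a^n\phi(b^n x),\qquad x\in\mathbb{R}.$$ Suppose that $|\phi'(x)|\le 1$ for all $x\in[0,1]$ and that $a^2+\frac{a}{b}<1$. Then $$\dim_H\big[\mathrm{graph}(w^{\phi}_{a,b})\big]\le \log_h(1/b),$$ where $$h=\sqrt{\frac{1}{2}\left[\frac{2}{b^2}+a^2+\sqrt{\frac{4}{b^4}+a^4}\right]}.$$
   Context: $\mathrm{graph}(w)=\{(x,w(x)):x\in\mathbb{R}\}\subset\mathbb{R}^2$ denotes the graph of a function $w:\mathbb{R}\to\mathbb{R}$. $\dim_H[F]$ denotes the Hausdorff dimension of $F\subset\mathbb{R}^2$ with respect to the Euclidean metric. $C^1$ on $[0,1]$ means continuously differentiable, with one-sided derivatives at the endpoints. $\log_h(1/b)=\ln(1/b)/\ln h$. *)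

theory Defs
  imports "HOL-Analysis.Analysis"
begin

text \<open>
  \<open>diam_pow s U\<close> is $|U|^s$ with the usual conventions $|\emptyset|^s = 0$ for all \<open>s\<close>, and
  $|U|^0 = 1$ for every nonempty \<open>U\<close>; the latter needs a separate case since
  \<open>0 powr 0 = 0\<close> in HOL.
\<close>

definition diam_pow :: "real \<Rightarrow> 'a::metric_space set \<Rightarrow> real" where
  "diam_pow s U = (if U = {} then 0 else if s = 0 then 1 else diameter U powr s)"

text \<open>Boundedness is required explicitly because \<^const>\<open>diameter\<close> is real-valued
  and carries no information for unbounded sets.\<close>

definition delta_covers :: "real \<Rightarrow> 'a::metric_space set \<Rightarrow> (nat \<Rightarrow> 'a set) set" where
  "delta_covers \<delta> F = {U. F \<subseteq> (\<Union>i. U i) \<and> (\<forall>i. bounded (U i) \<and> diameter (U i) \<le> \<delta>)}"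

definition hausdorff_premeasure :: "real \<Rightarrow> real \<Rightarrow> 'a::metric_space set \<Rightarrow> ennreal" where
  "hausdorff_premeasure s \<delta> F = (INF U\<in>delta_covers \<delta> F. \<Sum>i. ennreal (diam_pow s (U i)))"

definition hausdorff_measure :: "real \<Rightarrow> 'a::metric_space set \<Rightarrow> ennreal" where
  "hausdorff_measure s F = (SUP \<delta>\<in>{0<..}. hausdorff_premeasure s \<delta> F)"

text \<open>The value is \<open>\<infinity>\<close> (the infimum of the empty set) if no \<open>s\<close> qualifies.\<close>

definition hausdorff_dim :: "'a::metric_space set \<Rightarrow> ereal" where
  "hausdorff_dim F = Inf {ereal s | s. 0 \<le> s \<and> hausdorff_measure s F = 0}"

text \<open>Only the values of \<open>\<phi>\<close> on $[0,1)$ matter; if \<open>\<phi> 0 = \<phi> 1\<close>, this extends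
  \<open>\<phi>\<close> restricted to $[0,1]$.\<close>

definition periodic_ext :: "(real \<Rightarrow> real) \<Rightarrow> real \<Rightarrow> real" where
  "periodic_ext \<phi> x = \<phi> (frac x)"

definition weierstrass :: "(real \<Rightarrow> real) \<Rightarrow> real \<Rightarrow> nat \<Rightarrow> real \<Rightarrow> real" where
  "weierstrass \<phi> a b x = (\<Sum>n. a ^ n * periodic_ext \<phi> (real b ^ n * x))"

text \<open>The product metric on \<^typ>\<open>real \<times> real\<close> is the Euclidean one.\<close>

definition graph :: "(real \<Rightarrow> real) \<Rightarrow> (real \<times> real) set" where
  "graph w = {(x, w x) | x. x \<in> UNIV}"

end

theory Submission imports Defs begin

text \<open>
  Since \<open>w x = \<phi> x + a * w (b * x)\<close> and the periodic extension of \<open>\<phi>\<close> is 1-Lipschitz, the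
  inverse of the expansion \<open>(x, w x) \<mapsto> (b * x, w (b * x))\<close> is \<open>h\<close>-Lipschitz on each branch: \<open>h\<close> is
  the largest singular value of the matrix with rows \<open>(1 / b, 0)\<close> and \<open>(1 / b, a)\<close>. Iterating \<open>n\<close>
  times, the graph above a unit interval is covered by \<open>b ^ n\<close> sets of diameter at most \<open>D * h ^ n\<close>,
  and \<open>b ^ n * (D * h ^ n) powr s\<close> tends to 0 as soon as \<open>b * h powr s < 1\<close>.
\<close>

section \<open>Null sets of the Hausdorff measure\<close>

text \<open>A supremum in \<open>ennreal\<close> vanishes iff every term does, and an infimum
  vanishes iff some member lies below each positive \<open>e\<close>. Null sets thus become a matter
  of exhibiting cheap covers.\<close>

lemma hausdorff_measure_eq_0_iff:
  "hausdorff_measure s F = 0 \<longleftrightarrow>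
    (\<forall>\<delta>>0. \<forall>e>0. \<exists>U\<in>delta_covers \<delta> F. (\<Sum>i. ennreal (diam_pow s (U i))) < e)"
proof -
  have "hausdorff_measure s F = 0 \<longleftrightarrow> (\<forall>\<delta>>0. hausdorff_premeasure s \<delta> F \<le> 0)"
    unfolding hausdorff_measure_def le_zero_eq[symmetric] SUP_le_iff by auto
  also have "\<dots> \<longleftrightarrow> (\<forall>\<delta>>0. \<forall>e>0. \<exists>U\<in>delta_covers \<delta> F. (\<Sum>i. ennreal (diam_pow s (U i))) < e)"
    unfolding hausdorff_premeasure_def INF_le_iff by auto
  finally show ?thesis .
qed

text \<open>Countable subadditivity for null sets: the allowance is split geometrically among the
  \<open>F j\<close>. This reduces the graph over the whole line to its pieces over unit
  intervals.\<close>

lemma hausdorff_measure_UN_eq_0: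
  fixes F :: "nat \<Rightarrow> 'a::metric_space set"
  assumes "\<And>j. hausdorff_measure s (F j) = 0"
  shows "hausdorff_measure s (\<Union>j. F j) = 0"
  unfolding hausdorff_measure_eq_0_iff
proof (intro allI impI)
  fix \<delta> :: real and e :: ennreal assume "\<delta> > 0" "e > 0"
  \<comment> \<open>\<open>e\<close> may be infinite, so a positive real below it is split
    instead.\<close>
  obtain r :: real where r: "0 < r" "ennreal r < e"
    using \<open>e > 0\<close>
    by (metis dense ennreal_cases ennreal_less_zero_iff less_top_ennreal order_less_trans top.not_eq_extremum)
  have pos: "ennreal (r * (1/2) ^ Suc j) > 0" for j
    using r by simp
  have "\<forall>j. \<exists>U. U \<in> delta_covers \<delta> (F j) \<and>
      (\<Sum>i. ennreal (diam_pow s (U i))) < ennreal (r * (1/2) ^ Suc j)"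
    using assms \<open>\<delta> > 0\<close> pos unfolding hausdorff_measure_eq_0_iff by blast
  then obtain U where U: "\<And>j. U j \<in> delta_covers \<delta> (F j)"
    and lt: "\<And>j. (\<Sum>i. ennreal (diam_pow s (U j i))) < ennreal (r * (1/2) ^ Suc j)"
    by metis
  \<comment> \<open>A cover is a single sequence, so the double family is enumerated by the pairing
    function.\<close>
  define V where "V i = (case prod_decode i of (j, k) \<Rightarrow> U j k)" for i
  have "(\<Union>j. F j) \<subseteq> (\<Union>i. V i)"
  proof
    fix x assume "x \<in> (\<Union>j. F j)"
    then obtain j k where "x \<in> U j k"
      using U unfolding delta_covers_def by blast
    then have "x \<in> V (prod_encode (j, k))" by (simp add: V_def)
    then show "x \<in> (\<Union>i. V i)" by blast
  qed
  moreover have "bounded (V i) \<and> diameter (V i) \<le> \<delta>" for i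
    using U unfolding V_def delta_covers_def by (auto split: prod.split)
  ultimately have "V \<in> delta_covers \<delta> (\<Union>j. F j)"
    by (simp add: delta_covers_def)
  moreover have "(\<Sum>i. ennreal (diam_pow s (V i))) < e"
  proof -
    have "(\<Sum>i. ennreal (diam_pow s (V i))) = (\<Sum>j. \<Sum>k. ennreal (diam_pow s (U j k)))"
      using suminf_ennreal_2dimen[of "\<lambda>j. \<Sum>k. ennreal (diam_pow s (U j k))"
          "\<lambda>(j, k). ennreal (diam_pow s (U j k))"]
      by (simp add: V_def case_prod_beta)
    also have "\<dots> \<le> (\<Sum>j. ennreal (r * (1/2) ^ Suc j))"
      by (intro suminf_le summableI order_less_imp_le[OF lt])
    also have "\<dots> = ennreal r"
      using sums_mult[OF power_half_series, of r] r
      by (intro suminf_ennreal_eq) auto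
    finally show ?thesis using r by simp
  qed
  ultimately show "\<exists>U\<in>delta_covers \<delta> (\<Union>j. F j). (\<Sum>i. ennreal (diam_pow s (U i))) < e" by blast
qed

text \<open>The limit of \<open>d\<close> makes the covers eventually fine enough for any
  \<open>\<delta>\<close>, and the limit of \<open>N n * d n powr s\<close>, which dominates their
  sums, makes them cheap.\<close>

lemma hausdorff_measure_eq_0_finite_covers:
  fixes F :: "'a::metric_space set" and U :: "nat \<Rightarrow> nat \<Rightarrow> 'a set"
  assumes "0 < s"
    and cover: "\<And>n. F \<subseteq> (\<Union>k<N n. U n k)"
    and bounded: "\<And>n k. k < N n \<Longrightarrow> bounded (U n k)"
    and diam: "\<And>n k. k < N n \<Longrightarrow> diameter (U n k) \<le> d n"
    and d: "d \<longlonglongrightarrow> 0" and Nd: "(\<lambda>n. real (N n) * d n powr s) \<longlonglongrightarrow> 0"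
  shows "hausdorff_measure s F = 0"
  unfolding hausdorff_measure_eq_0_iff
proof (intro allI impI)
  fix \<delta> :: real and e :: ennreal assume "\<delta> > 0" "e > 0"
  obtain r :: real where r: "0 < r" "ennreal r < e"
    using \<open>e > 0\<close>
    by (metis dense ennreal_cases ennreal_less_zero_iff less_top_ennreal order_less_trans top.not_eq_extremum)
  have "eventually (\<lambda>n. d n < \<delta> \<and> real (N n) * d n powr s < r) sequentially"
    using order_tendstoD(2)[OF d \<open>\<delta> > 0\<close>] order_tendstoD(2)[OF Nd \<open>r > 0\<close>]
    by eventually_elim simp
  then obtain n where n: "d n < \<delta>" "real (N n) * d n powr s < r"
    by (auto simp: eventually_sequentially)
  \<comment> \<open>Padding the finite cover to a sequence is free, since
    \<open>diam_pow s {} = 0\<close>.\<close>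
  define V where "V k = (if k < N n then U n k else {})" for k
  have "F \<subseteq> (\<Union>k. V k)"
    using cover[of n] by (fastforce simp: V_def)
  moreover have "bounded (V k) \<and> diameter (V k) \<le> \<delta>" for k
    using bounded[of k n] diam[of k n] n \<open>\<delta> > 0\<close> by (auto simp: V_def)
  ultimately have "V \<in> delta_covers \<delta> F"
    by (simp add: delta_covers_def)
  moreover have "(\<Sum>k. ennreal (diam_pow s (V k))) < e"
  proof -
    have "diam_pow s (V k) \<le> d n powr s" for k
      using diam[of k n] bounded[of k n] \<open>0 < s\<close>
      by (auto simp: V_def diam_pow_def intro!: powr_mono2 diameter_ge_0)
    then have "(\<Sum>k<N n. ennreal (diam_pow s (V k))) \<le> (\<Sum>k<N n. ennreal (d n powr s))"
      by (intro sum_mono ennreal_leI) auto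
    also have "\<dots> = ennreal (real (N n) * d n powr s)"
      by (simp add: ennreal_mult ennreal_of_nat_eq_real_of_nat)
    also have "\<dots> < e"
      using n r by (meson ennreal_leI le_less_trans less_imp_le)
    also have "(\<Sum>k<N n. ennreal (diam_pow s (V k))) = (\<Sum>k. ennreal (diam_pow s (V k)))"
      by (rule suminf_finite[symmetric]) (auto simp: V_def diam_pow_def)
    finally show ?thesis .
  qed
  ultimately show "\<exists>U\<in>delta_covers \<delta> F. (\<Sum>i. ennreal (diam_pow s (U i))) < e" by blast
qed

lemma hausdorff_dim_le:
  assumes "0 \<le> t" and "\<And>s. t < s \<Longrightarrow> hausdorff_measure s F = 0"
  shows "hausdorff_dim F \<le> ereal t"
proof (rule ereal_le_epsilon2)
  fix e :: real assume "0 < e"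
  then show "hausdorff_dim F \<le> ereal t + ereal e"
    unfolding hausdorff_dim_def using assms by (intro Inf_lower) auto
qed

section \<open>The periodic extension and the Weierstrass function\<close>

text \<open>Within one unit cell the bound is that of \<open>\<phi>\<close>. Across cells the
  comparison passes through integers, where \<open>\<phi> 0 = \<phi> 1\<close> removes any
  jump.\<close>

lemma lipschitz_on_periodic_ext:
  assumes lip: "L-lipschitz_on {0..1} \<phi>" and "\<phi> 0 = \<phi> 1"
  shows "L-lipschitz_on UNIV (periodic_ext \<phi>)"
proof -
  have \<phi>: "\<bar>\<phi> u - \<phi> v\<bar> \<le> L * \<bar>u - v\<bar>" if "u \<in> {0..1}" "v \<in> {0..1}" for u v
    using that lipschitz_onD[OF lip, of u v] by (simp add: dist_real_def)
  have "L \<ge> 0" using lip by (rule lipschitz_on_nonneg)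
  have fr: "frac x \<in> {0..1}" for x :: real
    using frac_ge_0[of x] frac_lt_1[of x] by auto
  have le: "\<bar>periodic_ext \<phi> x - periodic_ext \<phi> y\<bar> \<le> L * (y - x)" if "x \<le> y" for x y
  proof (cases "\<lfloor>x\<rfloor> = \<lfloor>y\<rfloor>")
    case True
    then have "\<bar>frac x - frac y\<bar> = y - x" using that by (simp add: frac_def)
    then show ?thesis using \<phi>[OF fr fr, of x y] by (simp add: periodic_ext_def)
  next
    case False
    have "\<lfloor>x\<rfloor> \<le> \<lfloor>y\<rfloor>" using that by (rule floor_mono)
    with False have "\<lfloor>x\<rfloor> + 1 \<le> \<lfloor>y\<rfloor>" by simp
    then have floors: "real_of_int \<lfloor>x\<rfloor> + 1 \<le> real_of_int \<lfloor>y\<rfloor>" by linarith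
    \<comment> \<open>From \<open>x\<close> up to the next integer, then from the integer below
      \<open>y\<close> up to \<open>y\<close>: the two lengths add up to at most
      \<open>y - x\<close>.\<close>
    have "\<bar>\<phi> (frac x) - \<phi> (frac y)\<bar> \<le> \<bar>\<phi> (frac x) - \<phi> 1\<bar> + \<bar>\<phi> 0 - \<phi> (frac y)\<bar>"
      using \<open>\<phi> 0 = \<phi> 1\<close> by linarith
    also have "\<dots> \<le> L * (1 - frac x) + L * frac y"
      using \<phi>[OF fr, of 1 x] \<phi>[OF _ fr, of 0 y] frac_lt_1[of x] frac_ge_0[of y]
      by (intro add_mono) auto
    also have "\<dots> = L * (1 - frac x + frac y)" by (simp add: algebra_simps)
    also have "\<dots> \<le> L * (y - x)"
      using floors \<open>L \<ge> 0\<close> by (intro mult_left_mono) (auto simp: frac_def)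
    finally show ?thesis by (simp add: periodic_ext_def)
  qed
  show ?thesis
  proof (rule lipschitz_onI)
    fix x y :: real
    show "dist (periodic_ext \<phi> x) (periodic_ext \<phi> y) \<le> L * dist x y"
      using le[of x y] le[of y x] by (cases "x \<le> y") (auto simp: dist_real_def abs_if split: if_splits)
  qed fact
qed

lemma
  assumes a: "0 \<le> a" "a < 1" and B: "\<And>x. \<bar>periodic_ext \<phi> x\<bar> \<le> B"
  shows summable_weierstrass: "summable (\<lambda>n. a ^ n * periodic_ext \<phi> (real b ^ n * x))"
    and abs_weierstrass_le: "\<bar>weierstrass \<phi> a b x\<bar> \<le> B / (1 - a)"
proof -
  have sums: "(\<lambda>n. a ^ n * B) sums (B / (1 - a))"
    using sums_mult2[OF geometric_sums, of a B] a by simp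
  have le: "norm (a ^ n * periodic_ext \<phi> (real b ^ n * x)) \<le> a ^ n * B" for n
    using B a by (auto simp: abs_mult intro!: mult_left_mono)
  show "summable (\<lambda>n. a ^ n * periodic_ext \<phi> (real b ^ n * x))"
    by (rule summable_comparison_test'[OF sums_summable[OF sums]]) (rule le)
  show "\<bar>weierstrass \<phi> a b x\<bar> \<le> B / (1 - a)"
    using norm_suminf_le[OF le sums_summable[OF sums]] sums_unique[OF sums]
    by (simp add: weierstrass_def)
qed

text \<open>Split off the term \<open>n = 0\<close> and shift the index, using
  \<open>b ^ Suc n * x = b ^ n * (b * x)\<close>. This self-affinity drives the covering
  argument.\<close>

lemma weierstrass_functional_eq:
  assumes "0 \<le> a" "a < 1" and "\<And>x. \<bar>periodic_ext \<phi> x\<bar> \<le> B"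
  shows "weierstrass \<phi> a b x = periodic_ext \<phi> x + a * weierstrass \<phi> a b (real b * x)"
proof -
  have "weierstrass \<phi> a b x
      = periodic_ext \<phi> x + (\<Sum>n. a * (a ^ n * periodic_ext \<phi> (real b ^ n * (real b * x))))"
    using suminf_split_head[OF summable_weierstrass[OF assms, of b x]]
    by (simp add: weierstrass_def mult_ac)
  also have "\<dots> = periodic_ext \<phi> x + a * weierstrass \<phi> a b (real b * x)"
    using suminf_mult[OF summable_weierstrass[OF assms, of b "real b * x"], of a]
    by (simp add: weierstrass_def)
  finally show ?thesis .
qed

section \<open>The contraction ratio\<close>

text \<open>\<open>largest_sv a b\<close> is the largest singular value of the matrix with rows \<open>(1 / b, 0)\<close> and
  \<open>(1 / b, a)\<close>.\<close>

definition largest_sv :: "real \<Rightarrow> real \<Rightarrow> real" where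
  "largest_sv a b = sqrt (1 / 2 * (2 / b ^ 2 + a ^ 2 + sqrt (4 / b ^ 4 + a ^ 4)))"

lemma largest_sv_square_eq:
  "(largest_sv a b)\<^sup>2 = 1 / 2 * (2 / b ^ 2 + a ^ 2 + sqrt (4 / b ^ 4 + a ^ 4))"
  unfolding largest_sv_def by (intro real_sqrt_pow2) simp

text \<open>For the matrix \<open>M\<close> described above, the quadratic is the characteristic
  polynomial of the transpose of \<open>M\<close> times \<open>M\<close>: trace
  \<open>2 / b\<^sup>2 + a\<^sup>2\<close>, determinant \<open>a\<^sup>2 / b\<^sup>2\<close>. The
  inner square root, \<open>q\<close> below, is that of its discriminant.\<close>

lemma largest_sv_root:
  fixes a b :: real
  assumes "b \<noteq> 0"
  defines "l \<equiv> (largest_sv a b)\<^sup>2"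
  shows "l\<^sup>2 - (2 / b\<^sup>2 + a\<^sup>2) * l + a\<^sup>2 / b\<^sup>2 = 0"
proof -
  define c where "c = 1 / b\<^sup>2"
  define q where "q = sqrt (4 / b ^ 4 + a ^ 4)"
  have q2: "q\<^sup>2 = 4 * c\<^sup>2 + (a\<^sup>2)\<^sup>2"
    unfolding q_def c_def by (subst real_sqrt_pow2) (auto simp: field_simps)
  have q: "q = 2 * l - 2 * c - a\<^sup>2"
    unfolding l_def largest_sv_square_eq q_def c_def by (simp add: add_divide_distrib)
  have "l\<^sup>2 - (2 * c + a\<^sup>2) * l + a\<^sup>2 * c = (q\<^sup>2 - (4 * c\<^sup>2 + (a\<^sup>2)\<^sup>2)) / 4"
    unfolding q by (simp add: algebra_simps power2_eq_square)
  then show ?thesis using q2 by (simp add: c_def)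
qed

text \<open>Drop either summand under the inner square root. The first bound gives
  \<open>l > a\<^sup>2\<close> in the contraction estimate, the second that the ratio is
  positive.\<close>

lemma largest_sv_square_ge:
  fixes a b :: real
  shows "a\<^sup>2 + 1 / b\<^sup>2 \<le> (largest_sv a b)\<^sup>2" and "2 / b\<^sup>2 \<le> (largest_sv a b)\<^sup>2"
proof -
  have "sqrt ((a\<^sup>2)\<^sup>2) \<le> sqrt (4 / b ^ 4 + a ^ 4)" "sqrt ((2 / b\<^sup>2)\<^sup>2) \<le> sqrt (4 / b ^ 4 + a ^ 4)"
    by (auto intro!: real_sqrt_le_mono simp: power_divide)
  then have q: "a\<^sup>2 \<le> sqrt (4 / b ^ 4 + a ^ 4)" "2 / b\<^sup>2 \<le> sqrt (4 / b ^ 4 + a ^ 4)"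
    by (simp_all only: real_sqrt_abs abs_power2 abs_of_nonneg[OF divide_nonneg_nonneg]
        zero_le_power2 zero_le_numeral)
  show "a\<^sup>2 + 1 / b\<^sup>2 \<le> (largest_sv a b)\<^sup>2"
    using q(1) unfolding largest_sv_square_eq by (simp add: field_simps)
  show "2 / b\<^sup>2 \<le> (largest_sv a b)\<^sup>2"
    using add_mono[OF q(2) zero_le_power2[of a]] unfolding largest_sv_square_eq
    by (simp add: field_simps)
qed

text \<open>The matrix sends \<open>(b * X, Y)\<close> to \<open>(X, X + a * Y)\<close>, the worst
  case allowed by the bounds on \<open>v\<close> and \<open>y\<close>. The right side minus the left
  is then a quadratic form in \<open>X\<close> and \<open>Y\<close> which the choice of
  \<open>l\<close> makes degenerate, hence a positive multiple of a square.\<close>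

lemma largest_sv_contraction:
  fixes a b :: real
  assumes "0 < b" "0 \<le> a" "0 \<le> X" "0 \<le> Y" "\<bar>v\<bar> \<le> X" "\<bar>y\<bar> \<le> Y"
  shows "X\<^sup>2 + (v + a * y)\<^sup>2 \<le> (largest_sv a b)\<^sup>2 * ((b * X)\<^sup>2 + Y\<^sup>2)"
proof -
  define l where "l = (largest_sv a b)\<^sup>2"
  define p where "p = l * b\<^sup>2 - 2"
  define r where "r = l - a\<^sup>2"
  have "r > 0"
    using largest_sv_square_ge(1)[of a b] \<open>0 < b\<close> unfolding r_def l_def
    by (smt (verit) zero_less_divide_1_iff zero_less_power)
  \<comment> \<open>The form is \<open>p * X\<^sup>2 - 2 * a * X * Y + r * Y\<^sup>2\<close>, and
    its determinant \<open>p * r - a\<^sup>2\<close> vanishes because \<open>l\<close> is a root of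
    the quadratic.\<close>
  have pr: "p * r = a\<^sup>2"
  proof -
    have "p * r = b\<^sup>2 * (l\<^sup>2 - (2 / b\<^sup>2 + a\<^sup>2) * l + a\<^sup>2 / b\<^sup>2) + a\<^sup>2"
      using \<open>0 < b\<close> unfolding p_def r_def by (simp add: field_simps power2_eq_square)
    then show ?thesis using largest_sv_root[of b a] \<open>0 < b\<close> by (simp add: l_def)
  qed
  have "\<bar>v + a * y\<bar> \<le> X + a * Y"
    using assms abs_triangle_ineq[of v "a * y"] mult_left_mono[of "\<bar>y\<bar>" Y a]
    by (simp add: abs_mult)
  then have "(v + a * y)\<^sup>2 \<le> (X + a * Y)\<^sup>2"
    by (rule abs_le_square_iff[THEN iffD1, OF order_trans]) simp
  moreover have "r * (l * ((b * X)\<^sup>2 + Y\<^sup>2) - X\<^sup>2 - (X + a * Y)\<^sup>2) = (a * X - r * Y)\<^sup>2"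
  proof -
    have "l * ((b * X)\<^sup>2 + Y\<^sup>2) - X\<^sup>2 - (X + a * Y)\<^sup>2 = p * X\<^sup>2 - 2 * a * X * Y + r * Y\<^sup>2"
      unfolding p_def r_def by (simp add: algebra_simps power2_eq_square)
    then have "r * (l * ((b * X)\<^sup>2 + Y\<^sup>2) - X\<^sup>2 - (X + a * Y)\<^sup>2)
        = (p * r) * X\<^sup>2 - 2 * a * X * r * Y + r\<^sup>2 * Y\<^sup>2"
      by (simp add: algebra_simps power2_eq_square)
    then show ?thesis unfolding pr by (simp add: algebra_simps power2_eq_square)
  qed
  then have "0 \<le> l * ((b * X)\<^sup>2 + Y\<^sup>2) - X\<^sup>2 - (X + a * Y)\<^sup>2"
    using \<open>r > 0\<close> by (metis zero_le_mult_iff zero_le_power2 not_less)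
  ultimately show ?thesis by (simp add: l_def)
qed

text \<open>Both roots lie below 1 if the characteristic polynomial is positive at 1, which is
  \<open>key\<close> up to the factor \<open>b\<^sup>2\<close>, and the trace is less than
  2.\<close>

lemma largest_sv_less_1:
  fixes a b :: real
  assumes "2 \<le> b" "0 \<le> a" "a\<^sup>2 + a / b < 1"
  shows "largest_sv a b < 1"
proof -
  define l where "l = (largest_sv a b)\<^sup>2"
  have b2: "4 \<le> b\<^sup>2" using power_mono[OF \<open>2 \<le> b\<close>, of 2] by simp
  have key: "a\<^sup>2 * (b\<^sup>2 - 1) < b\<^sup>2 - 2"
  \<comment> \<open>For large \<open>a\<close> the assumption \<open>a\<^sup>2 < 1 - a / b\<close>
    suffices, the subtracted term contributing at least 1. For small \<open>a\<close>, squaring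
    \<open>a * (b\<^sup>2 - 1) < b\<close> suffices because
    \<open>b\<^sup>2 \<ge> 4\<close>.\<close>
  proof (cases "b \<le> a * (b\<^sup>2 - 1)")
    case True
    have "a\<^sup>2 * (b\<^sup>2 - 1) < (1 - a / b) * (b\<^sup>2 - 1)"
      using assms b2 by (intro mult_strict_right_mono) auto
    also have "\<dots> = (b\<^sup>2 - 1) - (a * (b\<^sup>2 - 1)) / b" by (simp add: algebra_simps diff_divide_distrib)
    also have "\<dots> \<le> (b\<^sup>2 - 1) - b / b"
      using True assms by (intro diff_left_mono divide_right_mono) auto
    finally show ?thesis using assms by simp
  next
    case False
    have "(a * (b\<^sup>2 - 1))\<^sup>2 < b\<^sup>2"
      using False assms b2 by (intro power_strict_mono) auto
    also have "\<dots> \<le> (b\<^sup>2 - 2) * (b\<^sup>2 - 1)"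
    proof -
      have "0 \<le> (b\<^sup>2 - 4) * b\<^sup>2" using b2 by (intro mult_nonneg_nonneg) auto
      then show ?thesis by (simp add: algebra_simps)
    qed
    finally have "(a\<^sup>2 * (b\<^sup>2 - 1)) * (b\<^sup>2 - 1) < (b\<^sup>2 - 2) * (b\<^sup>2 - 1)"
      by (simp add: power2_eq_square mult_ac)
    then show ?thesis using b2 by (simp add: mult_less_cancel_right_disj)
  qed
  have "sqrt (4 / b ^ 4 + a ^ 4) < 2 - 2 / b\<^sup>2 - a\<^sup>2"
  proof (rule real_less_lsqrt)
    define c where "c = 1 / b\<^sup>2"
    have c: "c \<le> 1 / 4" "c > 0" using b2 unfolding c_def by (auto simp: divide_simps)
    have k: "a\<^sup>2 * (1 - c) < 1 - 2 * c"
    proof -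
      have "a\<^sup>2 * (b\<^sup>2 - 1) * c < (b\<^sup>2 - 2) * c"
        using key c by (intro mult_strict_right_mono) auto
      then show ?thesis using assms unfolding c_def by (simp add: field_simps)
    qed
    have "a\<^sup>2 < 1" using assms by (smt (verit) divide_nonneg_nonneg)
    moreover have "2 / b\<^sup>2 = 2 * c" by (simp add: c_def)
    ultimately show "0 \<le> 2 - 2 / b\<^sup>2 - a\<^sup>2" using c by linarith
    \<comment> \<open>The fourth powers cancel, leaving four times the gap in \<open>k\<close>,
      which is \<open>key\<close> divided by \<open>b\<^sup>2\<close>.\<close>
    have "(2 - 2 * c - a\<^sup>2)\<^sup>2 - (4 * c\<^sup>2 + (a\<^sup>2)\<^sup>2) = 4 * (1 - 2 * c - a\<^sup>2 * (1 - c))"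
      by (simp add: algebra_simps power2_eq_square)
    then have "4 * c\<^sup>2 + (a\<^sup>2)\<^sup>2 < (2 - 2 * c - a\<^sup>2)\<^sup>2" using k by simp
    then show "4 / b ^ 4 + a ^ 4 < (2 - 2 / b\<^sup>2 - a\<^sup>2)\<^sup>2"
      unfolding c_def by (simp add: power_divide)
  qed
  then have "(largest_sv a b)\<^sup>2 < 1" unfolding largest_sv_square_eq by simp
  then show ?thesis by (simp add: abs_square_less_1)
qed

section \<open>Covering the graph by contracted copies of unit pieces\<close>

lemma weierstrass_graph_contraction:
  assumes "0 < b" "0 \<le> a" "a < 1" and B: "\<And>x. \<bar>periodic_ext \<phi> x\<bar> \<le> B"
    and lip: "1-lipschitz_on UNIV (periodic_ext \<phi>)"
  defines "G \<equiv> \<lambda>x. (x, weierstrass \<phi> a b x)"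
  shows "dist (G u) (G v) \<le> largest_sv a b ^ n * dist (G (real b ^ n * u)) (G (real b ^ n * v))"
proof (induction n arbitrary: u v)
  case (Suc n)
  let ?w = "weierstrass \<phi> a b" and ?h = "largest_sv a b"
  \<comment> \<open>The functional equation writes the vertical difference as
    \<open>v + a * y\<close>, with \<open>v\<close> a difference of the periodic extension. The
    contraction estimate then applies to squared distances with
    \<open>X = \<bar>u - v\<bar>\<close>, for any two abscissae.\<close>
  have step: "dist (G u) (G v) \<le> ?h * dist (G (b * u)) (G (b * v))" for u v :: real
  proof (rule power2_le_imp_le)
    have "(dist (G u) (G v))\<^sup>2 = \<bar>u - v\<bar>\<^sup>2 + (?w u - ?w v)\<^sup>2"
      by (simp add: G_def dist_prod_def dist_real_def)
    also have "?w u - ?w v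
        = (periodic_ext \<phi> u - periodic_ext \<phi> v) + a * (?w (b * u) - ?w (b * v))"
      using weierstrass_functional_eq[OF assms(2,3) B, of b u]
        weierstrass_functional_eq[OF assms(2,3) B, of b v] by (simp add: algebra_simps)
    also have "\<bar>u - v\<bar>\<^sup>2 + \<dots>\<^sup>2
        \<le> ?h\<^sup>2 * ((b * \<bar>u - v\<bar>)\<^sup>2 + \<bar>?w (b * u) - ?w (b * v)\<bar>\<^sup>2)"
      using lipschitz_onD[OF lip, of u v] assms(1,2)
      by (intro largest_sv_contraction) (auto simp: dist_real_def)
    also have "\<dots> = (?h * dist (G (b * u)) (G (b * v)))\<^sup>2"
      by (simp add: G_def dist_prod_def dist_real_def power_mult_distrib power2_eq_square
          right_diff_distrib[symmetric] flip: abs_mult)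
    finally show "(dist (G u) (G v))\<^sup>2 \<le> (?h * dist (G (b * u)) (G (b * v)))\<^sup>2" .
    show "0 \<le> ?h * dist (G (b * u)) (G (b * v))" by (simp add: largest_sv_def)
  qed
  note step[of u v]
  also have "?h * dist (G (b * u)) (G (b * v))
      \<le> ?h * (?h ^ n * dist (G (real b ^ n * (b * u))) (G (real b ^ n * (b * v))))"
    by (intro mult_left_mono Suc.IH) (simp add: largest_sv_def)
  finally show ?case by (simp add: mult_ac)
qed simp

text \<open>Multiplication by \<open>b ^ n\<close> maps each cell of length \<open>b ^ (-n)\<close>
  onto a unit interval, over which the graph has diameter at most \<open>D\<close>. The cover sums
  are thus at most \<open>D powr s * (b * h powr s) ^ n\<close>, with \<open>h\<close> the
  contraction ratio.\<close>

lemma hausdorff_measure_unit_piece: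
  assumes b: "0 < b" and a: "0 \<le> a" "a < 1" and B: "\<And>x. \<bar>periodic_ext \<phi> x\<bar> \<le> B"
    and lip: "1-lipschitz_on UNIV (periodic_ext \<phi>)"
    and "0 < s" and h1: "largest_sv a b < 1" and bh: "real b * largest_sv a b powr s < 1"
  shows "hausdorff_measure s ((\<lambda>x. (x, weierstrass \<phi> a b x)) ` {of_int m..of_int m + 1}) = 0"
proof -
  let ?w = "weierstrass \<phi> a b" and ?h = "largest_sv a b"
  define G where "G = (\<lambda>x. (x, ?w x))"
  \<comment> \<open>Horizontal extent 1 plus twice the uniform bound on the Weierstrass
    function.\<close>
  define D where "D = 1 + 2 * (B / (1 - a))"
  have h0: "0 \<le> ?h" by (simp add: largest_sv_def)
  have D: "dist (G u) (G v) \<le> D" if "\<bar>u - v\<bar> \<le> 1" for u v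
  proof -
    have "dist (G u) (G v) \<le> \<bar>u - v\<bar> + \<bar>?w u - ?w v\<bar>"
      by (simp add: G_def dist_prod_def dist_real_def
          sqrt_sum_squares_le_sum_abs[of "\<bar>_\<bar>" "\<bar>_\<bar>", simplified])
    then show ?thesis
      using that abs_weierstrass_le[OF a B, where b = b and x = u]
        abs_weierstrass_le[OF a B, where b = b and x = v] unfolding D_def by linarith
  qed
  have "D \<ge> 0" using D[of 0 0] by simp
  \<comment> \<open>The cells are described after scaling by \<open>b ^ n\<close>, which avoids
    division. They are closed and share endpoints.\<close>
  define U where "U n k = G ` {x. of_int m * real b ^ n + real k \<le> real b ^ n * x \<and>
      real b ^ n * x \<le> of_int m * real b ^ n + real k + 1}" for n k
  have diam: "dist p q \<le> D * ?h ^ n" if pq: "p \<in> U n k" "q \<in> U n k" for p q n k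
  proof -
    let ?m = "of_int m * real b ^ n + real k"
    obtain u v where uv: "p = G u" "q = G v"
      and "?m \<le> real b ^ n * u" "real b ^ n * u \<le> ?m + 1"
      and "?m \<le> real b ^ n * v" "real b ^ n * v \<le> ?m + 1"
      using pq unfolding U_def by blast
    then have "\<bar>real b ^ n * u - real b ^ n * v\<bar> \<le> 1" by linarith
    with uv have "dist p q \<le> ?h ^ n * D"
      using weierstrass_graph_contraction[OF b a B lip, of u v n]
        mult_left_mono[OF D, of "real b ^ n * u" "real b ^ n * v" "?h ^ n"] h0 by (simp add: G_def)
    then show ?thesis by (simp add: mult.commute)
  qed
  have "hausdorff_measure s (G ` {of_int m..of_int m + 1}) = 0"
  proof (rule hausdorff_measure_eq_0_finite_covers[OF \<open>0 < s\<close>])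
    fix n
    show "G ` {of_int m..of_int m + 1} \<subseteq> (\<Union>k<b ^ n. U n k)"
    proof
      fix p assume "p \<in> G ` {of_int m..of_int m + 1}"
      then obtain x where x: "p = G x" "of_int m \<le> x" "x \<le> of_int m + 1" by auto
      define z where "z = real b ^ n * (x - of_int m)"
      have z: "0 \<le> z" "z \<le> real (b ^ n)"
        using x b mult_left_mono[of "x - of_int m" 1 "real b ^ n"] by (auto simp: z_def)
      have "\<exists>k<b ^ n. real k \<le> z \<and> z \<le> real k + 1"
      proof (cases "z = real (b ^ n)")
        \<comment> \<open>The right end of the unit interval belongs to the last cell; the floor
          would give the index \<open>b ^ n\<close>, one too large.\<close>
        case True
        then show ?thesis using b by (intro exI[of _ "b ^ n - 1"]) (auto simp: of_nat_diff)
      next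
        case False
        then have "nat \<lfloor>z\<rfloor> < b ^ n" using z by linarith
        then show ?thesis using z by (intro exI[of _ "nat \<lfloor>z\<rfloor>"]) auto
      qed
      then obtain k where "k < b ^ n" "real k \<le> z" "z \<le> real k + 1" by blast
      then have "p \<in> U n k" using x unfolding U_def z_def by (auto simp: algebra_simps)
      then show "p \<in> (\<Union>k<b ^ n. U n k)" using \<open>k < b ^ n\<close> by blast
    qed
    show "bounded (U n k)" for k
      unfolding bounded_two_points using diam by blast
    show "diameter (U n k) \<le> D * ?h ^ n" for k
      using diam \<open>0 \<le> D\<close> h0 by (intro diameter_le) (auto simp: dist_norm)
  next
    show "(\<lambda>n. D * ?h ^ n) \<longlonglongrightarrow> 0"
      using h0 h1 by (intro tendsto_mult_right_zero LIMSEQ_power_zero) simp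
    have "(?h ^ n) powr s = (?h powr s) ^ n" for n
      using h0 by (induction n) (auto simp: powr_mult)
    then have "real (b ^ n) * (D * ?h ^ n) powr s = D powr s * (real b * ?h powr s) ^ n" for n
      using \<open>0 \<le> D\<close> h0 by (simp add: powr_mult power_mult_distrib)
    moreover have "(\<lambda>n. D powr s * (real b * ?h powr s) ^ n) \<longlonglongrightarrow> 0"
      using bh by (intro tendsto_mult_right_zero LIMSEQ_power_zero) simp
    ultimately show "(\<lambda>n. real (b ^ n) * (D * ?h ^ n) powr s) \<longlonglongrightarrow> 0" by simp
  qed
  then show ?thesis by (simp add: G_def)
qed

theorem theorem1p2:
  fixes a :: real and b :: nat and \<phi> \<phi>' :: "real \<Rightarrow> real"
  assumes "0 < b"
    and "1 / real b < a" and "a < 1"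
    and "\<And>x. x \<in> {0..1} \<Longrightarrow> (\<phi> has_real_derivative \<phi>' x) (at x within {0..1})"
    and "continuous_on {0..1} \<phi>'"
    and "\<phi> 0 = \<phi> 1"
    and "\<And>x. x \<in> {0..1} \<Longrightarrow> \<bar>\<phi>' x\<bar> \<le> 1"
    and "a\<^sup>2 + a / real b < 1"
  shows "hausdorff_dim (graph (weierstrass \<phi> a b))
    \<le> ereal (log (sqrt (1 / 2 * (2 / real b ^ 2 + a ^ 2 + sqrt (4 / real b ^ 4 + a ^ 4))))
                 (1 / real b))"
proof -
  let ?h = "largest_sv a b"
  have a0: "0 < a" using assms(1,2) by (smt (verit) divide_nonneg_nonneg of_nat_0_le_iff)
  have b2: "2 \<le> b"
  proof (rule ccontr)
    assume "\<not> 2 \<le> b"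
    with \<open>0 < b\<close> have "b = 1" by simp
    with assms(2,3) show False by simp
  qed
  \<comment> \<open>The derivative bound enters through the mean value inequality on the convex set
    \<open>{0..1}\<close>.\<close>
  have \<phi>_lip: "1-lipschitz_on {0..1} \<phi>"
  proof (rule lipschitz_onI)
    fix x y :: real assume "x \<in> {0..1}" "y \<in> {0..1}"
    then show "dist (\<phi> x) (\<phi> y) \<le> 1 * dist x y"
      using field_differentiable_bound[of "{0..1}" \<phi> \<phi>' 1 x y] assms(4,7)
      by (auto simp: dist_norm norm_minus_commute)
  qed simp
  have lip: "1-lipschitz_on UNIV (periodic_ext \<phi>)"
    by (rule lipschitz_on_periodic_ext[OF \<phi>_lip assms(6)])
  have B: "\<bar>periodic_ext \<phi> x\<bar> \<le> \<bar>\<phi> 0\<bar> + 1" for x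
    using lipschitz_onD[OF \<phi>_lip, of "frac x" 0] frac_ge_0[of x] frac_lt_1[of x]
    by (simp add: periodic_ext_def dist_real_def)
  have h1: "?h < 1"
    using largest_sv_less_1[of "real b" a] b2 a0 assms(8) by simp
  have h0: "0 < ?h"
  proof -
    have "0 < ?h\<^sup>2"
      using largest_sv_square_ge(2)[of "real b" a] \<open>0 < b\<close>
      by (smt (verit) divide_pos_pos of_nat_0_less_iff zero_less_power)
    then show ?thesis by (simp add: largest_sv_def)
  qed
  \<comment> \<open>Only exponents \<open>s \<ge> 0\<close> compete in \<open>hausdorff_dim\<close>;
    here both logarithms in the quotient are negative.\<close>
  have pos: "0 \<le> log ?h (1 / real b)"
    using h0 h1 b2 by (simp add: log_def ln_div divide_nonneg_neg)
  have "hausdorff_measure s (graph (weierstrass \<phi> a b)) = 0" if s: "log ?h (1 / real b) < s" for s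
  proof -
    \<comment> \<open>Powers of a base below 1 decrease in the exponent, and the right side equals
      \<open>1 / b\<close>.\<close>
    have "?h powr s < ?h powr log ?h (1 / real b)"
      using h0 h1 s by (simp add: powr_less_mono')
    then have bh: "real b * ?h powr s < 1"
      using h0 h1 \<open>0 < b\<close> by (simp add: field_simps)
    \<comment> \<open>The integers are enumerated by \<open>int_decode\<close> to obtain a union
      indexed by \<open>nat\<close>.\<close>
    have "graph (weierstrass \<phi> a b) = (\<Union>j. (\<lambda>x. (x, weierstrass \<phi> a b x)) `
        {of_int (int_decode j)..of_int (int_decode j) + 1})"
    proof -
      have "\<exists>j. x \<in> {of_int (int_decode j)..of_int (int_decode j) + 1}" for x :: real
        by (rule exI[of _ "int_encode \<lfloor>x\<rfloor>"]) (simp; linarith)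
      then show ?thesis unfolding graph_def by blast
    qed
    also have "hausdorff_measure s \<dots> = 0"
      using s pos a0
      by (intro hausdorff_measure_UN_eq_0 hausdorff_measure_unit_piece[OF assms(1) _ assms(3) B lip _ h1 bh])
        auto
    finally show ?thesis .
  qed
  then have "hausdorff_dim (graph (weierstrass \<phi> a b)) \<le> ereal (log ?h (1 / real b))"
    by (rule hausdorff_dim_le[OF pos])
  then show ?thesis by (simp only: largest_sv_def)
qed

end
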